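(* Assume that the matrix $A$ is irreducible, and let $\omega=(\omega_i)$ be the Perron–Frobenius eigenvector of the transpose $A^t$, i.e. $A^t\omega=r(A)\,\omega$ with $r(A)$ the spectral radius. Then $f=\sum_i\omega_i\chi_{R_i}$ is a fixed point of the Perron–Frobenius operator $\mathcal{P}_\sigma$ on $L^2(\Lambda_A,\mu_A)$, that is, $\mathcal{P}_\sigma f=f$.
   Context: Let $N\ge 2$ and let $A=(A_{ij})_{i,j=0,\dots,N-1}$ be a matrix with entries in $\{0,1\}$ and $A_{ii}=1$ for all $i$. Irreducible means that some power $A^n$ has all entries positive. $\Lambda_A$ is the set of infinite sequences $x=(x_1x_2x_3\dots)$ with $x_i\in\{0,\dots,N-1\}$ and $A_{x_ix_{i+1}}=1$ for all $i\geq 1$, identified with a subset of $[0,1]$ through $x=\sum_{i\ge1}x_iN^{-i}$ (the at most countably many numbers with two expansions are counted as distinct points, one for each admissible expansion). $\delta_A$ is the Hausdorff dimension of this subset of $[0,1]$ and $\mu_A$ is the $\delta_A$-dimensional Hausdorff measure on it, normalized to be a probability measure. $R_i=\{x\in\Lambda_A:x_1=i\}$. $\sigma(x_1x_2x_3\dots)=(x_2x_3\dots)$ is the shift. The Perron–Frobenius operator $\mathcal{P}_\sigma$ is the adjoint of the composition operator $(T_\sigma\psi)(x)=\psi(\sigma(x))$ on $L^2(\Lambda_A,\mu_A)$. *)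

theory Defs
  imports "HOL-Analysis.Analysis" "Jordan_Normal_Form.Spectral_Radius"
begin

text \<open>The convention for \<open>d = 0\<close> makes nonempty covering sets count 1 (note that
  \<open>0 powr 0 = 0\<close> in HOL), so that the 0-dimensional Hausdorff measure is the counting measure.\<close>

definition hausdorff_gauge :: "real \<Rightarrow> 'a::metric_space set \<Rightarrow> real" where
  "hausdorff_gauge d U = (if U = {} then 0 else if d = 0 then 1 else diameter U powr d)"

definition hausdorff_premeasure :: "real \<Rightarrow> real \<Rightarrow> 'a::metric_space set \<Rightarrow> ennreal" where
  "hausdorff_premeasure d \<epsilon> S =
     (INF U \<in> {U :: nat \<Rightarrow> 'a set. S \<subseteq> (\<Union>i. U i) \<and> (\<forall>i. bounded (U i) \<and> diameter (U i) \<le> \<epsilon>)}.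
        \<Sum>i. ennreal (hausdorff_gauge d (U i)))"

definition hausdorff_measure :: "real \<Rightarrow> 'a::metric_space set \<Rightarrow> ennreal" where
  "hausdorff_measure d S = (SUP \<epsilon>\<in>{0<..}. hausdorff_premeasure d \<epsilon> S)"

text \<open>Stated for subsets of the line only, where the dimension is finite (at most 1).\<close>

definition hausdorff_dim :: "real set \<Rightarrow> real" where
  "hausdorff_dim S = Inf {d. 0 \<le> d \<and> hausdorff_measure d S = 0}"

definition square_integrable :: "'a measure \<Rightarrow> ('a \<Rightarrow> complex) \<Rightarrow> bool" where
  "square_integrable M f \<longleftrightarrow>
     f \<in> borel_measurable M \<and> integrable M (\<lambda>x. (cmod (f x))\<^sup>2)"

definition ae_rel :: "'a measure \<Rightarrow> (('a \<Rightarrow> complex) \<times> ('a \<Rightarrow> complex)) set" where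
  "ae_rel M = {(f, g). square_integrable M f \<and> square_integrable M g \<and> (AE x in M. f x = g x)}"

definition L2 :: "'a measure \<Rightarrow> ('a \<Rightarrow> complex) set set" where
  "L2 M = {f. square_integrable M f} // ae_rel M"

definition L2_class :: "'a measure \<Rightarrow> ('a \<Rightarrow> complex) \<Rightarrow> ('a \<Rightarrow> complex) set" where
  "L2_class M f = ae_rel M `` {f}"

definition L2_inner :: "'a measure \<Rightarrow> ('a \<Rightarrow> complex) set \<Rightarrow> ('a \<Rightarrow> complex) set \<Rightarrow> complex" where
  "L2_inner M F G = the_elem (\<Union>f\<in>F. \<Union>g\<in>G. {LINT x|M. f x * cnj (g x)})"

text \<open>For \<open>s\<close> such that \<open>\<psi> \<mapsto> \<psi> \<circ> s\<close> respects equality almost everywhere and square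
  integrability, the union below is the single class of \<open>\<psi> \<circ> s\<close>.\<close>

definition composition_op ::
    "'a measure \<Rightarrow> ('a \<Rightarrow> 'a) \<Rightarrow> ('a \<Rightarrow> complex) set \<Rightarrow> ('a \<Rightarrow> complex) set" where
  "composition_op M s F = (\<Union>\<psi>\<in>F. L2_class M (\<psi> \<circ> s))"

definition L2_adjoint ::
    "'a measure \<Rightarrow> (('a \<Rightarrow> complex) set \<Rightarrow> ('a \<Rightarrow> complex) set)
       \<Rightarrow> ('a \<Rightarrow> complex) set \<Rightarrow> ('a \<Rightarrow> complex) set" where
  "L2_adjoint M T G =
     (THE H. H \<in> L2 M \<and> (\<forall>F\<in>L2 M. L2_inner M (T F) G = L2_inner M F H))"

definition perron_frobenius_op ::
    "'a measure \<Rightarrow> ('a \<Rightarrow> 'a) \<Rightarrow> ('a \<Rightarrow> complex) set \<Rightarrow> ('a \<Rightarrow> complex) set" where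
  "perron_frobenius_op M s = L2_adjoint M (composition_op M s)"

definition irreducible_mat :: "real mat \<Rightarrow> bool" where
  "irreducible_mat A \<longleftrightarrow>
     (\<exists>n. \<forall>i<dim_row A. \<forall>j<dim_row A. (A ^\<^sub>m n) $$ (i, j) > 0)"

definition spec_rad :: "real mat \<Rightarrow> real" where
  "spec_rad A = spectral_radius (map_mat complex_of_real A)"

text \<open>Sequences are indexed from 0: the letter \<open>x\<^sub>i\<^sub>+\<^sub>1\<close> of \<open>x = (x\<^sub>1 x\<^sub>2 x\<^sub>3 \<dots>)\<close> is \<open>x i\<close>.\<close>

definition Lambda :: "real mat \<Rightarrow> (nat \<Rightarrow> nat) set" where
  "Lambda A = {x. (\<forall>i. x i < dim_row A) \<and> (\<forall>i. A $$ (x i, x (Suc i)) = 1)}"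

definition cyl :: "real mat \<Rightarrow> nat \<Rightarrow> (nat \<Rightarrow> nat) set" where
  "cyl A i = {x \<in> Lambda A. x 0 = i}"

definition shift :: "(nat \<Rightarrow> nat) \<Rightarrow> (nat \<Rightarrow> nat)" where
  "shift x = (\<lambda>i. x (Suc i))"

definition expansion_value :: "nat \<Rightarrow> (nat \<Rightarrow> nat) \<Rightarrow> real" where
  "expansion_value N x = (\<Sum>i. real (x i) / real N ^ Suc i)"

definition delta :: "real mat \<Rightarrow> real" where
  "delta A = hausdorff_dim (expansion_value (dim_row A) ` Lambda A)"

text \<open>The points of the measure space are the sequences themselves, so numbers with two admissible
  expansions give two points, and the \<open>\<sigma>\<close>-algebra is the Borel \<open>\<sigma>\<close>-algebra of the product topology
  on sequences (generated by the cylinder sets). As only countably many numbers have two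
  expansions, the set function below is countably additive when \<open>delta A > 0\<close>.\<close>

definition hausdorff_Lambda :: "real mat \<Rightarrow> (nat \<Rightarrow> nat) measure" where
  "hausdorff_Lambda A =
     measure_of (Lambda A) (sets (restrict_space borel (Lambda A)))
       (\<lambda>E. hausdorff_measure (delta A) (expansion_value (dim_row A) ` E))"

definition mu :: "real mat \<Rightarrow> (nat \<Rightarrow> nat) measure" where
  "mu A = uniform_measure (hausdorff_Lambda A) (Lambda A)"

end

theory Submission
  imports Defs
begin

text \<open>
  Write \<open>\<sigma>\<close> for the shift, \<open>\<mu> = mu A\<close>, \<open>\<delta> = delta A\<close> and \<open>r = spec_rad A\<close>. On the cylinder
  \<open>R\<^sub>i\<close> the shift is injective, its image consists of the sequences whose first letter may follow
  \<open>i\<close>, and on the values of the expansions it is the similarity \<open>t \<mapsto> N t - i\<close>. Scaling of the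
  Hausdorff measure gives
  \<open>N powr \<delta> * \<mu>(R\<^sub>i \<inter> \<sigma>\<^sup>-\<^sup>1 B) = (\<Sum>j. A\<^sub>i\<^sub>j \<mu>(B \<inter> R\<^sub>j))\<close> (lemma \<open>measure_mu_shift\<close>).
  Multiplying by \<open>\<omega>\<^sub>i\<close>, summing over \<open>i\<close> and using that \<open>\<omega>\<close> is an eigenvector of the transpose
  shows that the measure \<open>\<nu> = f \<mu>\<close> satisfies \<open>N powr \<delta> * \<nu>(\<sigma>\<^sup>-\<^sup>1 B) = r * \<nu>(B)\<close>. For
  \<open>B = Lambda A\<close> both sides contain the total mass of \<open>\<nu>\<close>, so \<open>r = N powr \<delta>\<close> as soon as \<open>\<nu>\<close> is
  nonzero, and \<open>\<nu>\<close> is invariant under the shift (lemma \<open>shift_invariant_density\<close>).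

  Invariance of \<open>\<nu>\<close> means \<open>\<integral> (\<psi> \<circ> \<sigma>) f d\<mu> = \<integral> \<psi> f d\<mu>\<close> for all \<open>\<psi>\<close>, which is the equation
  defining \<open>f\<close> as its own image under the adjoint of the composition operator. On \<open>Lambda A\<close>
  the function \<open>f\<close> lies between two positive constants, hence the composition operator is well
  defined on classes (lemma \<open>perron_frobenius_op_invariant_density\<close>).

  The argument does not use the value of \<open>\<delta>\<close>, nor that the Hausdorff measure of \<open>Lambda A\<close> is
  positive and finite: if that measure were zero, infinite, or not countably additive, then \<open>\<mu>\<close>
  would be the zero measure by the conventions of its definition, and \<open>\<nu>\<close>
  would be trivially invariant.
\<close>

section \<open>Hausdorff measure under similarities\<close>

lemma bounded_similarity_image:
  fixes g :: "'a::metric_space \<Rightarrow> 'b::metric_space"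
  assumes "\<And>x y. dist (g x) (g y) = c * dist x y" "bounded S"
  shows "bounded (g ` S)"
proof (cases "S = {}")
  case False
  then obtain x where "x \<in> S" by auto
  from assms(2) obtain e where e: "\<And>y. y \<in> S \<Longrightarrow> dist x y \<le> e"
    unfolding bounded_any_center[of S x] by auto
  have "dist (g x) (g y) \<le> \<bar>c\<bar> * e" if "y \<in> S" for y
    unfolding assms(1) by (rule mult_mono) (use e[OF that] in auto)
  then show ?thesis
    unfolding bounded_def by auto
qed simp

lemma diameter_similarity_image:
  fixes g :: "'a::real_normed_vector \<Rightarrow> 'b::real_normed_vector"
  assumes c: "c > 0" and g: "\<And>x y. dist (g x) (g y) = c * dist x y" and S: "bounded S"
  shows "diameter (g ` S) = c * diameter S"
proof (rule antisym)
  show "diameter (g ` S) \<le> c * diameter S"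
  proof (rule diameter_le)
    show "g ` S \<noteq> {} \<or> 0 \<le> c * diameter S"
      using c diameter_ge_0[OF S] by simp
    show "norm (x - y) \<le> c * diameter S" if "x \<in> g ` S" "y \<in> g ` S" for x y
      using that c diameter_bounded_bound[OF S] g by (auto simp: dist_norm[symmetric])
  qed
  have gS: "bounded (g ` S)"
    by (rule bounded_similarity_image[OF g S])
  have "diameter S \<le> diameter (g ` S) / c"
  proof (rule diameter_le)
    show "S \<noteq> {} \<or> 0 \<le> diameter (g ` S) / c"
      using c diameter_ge_0[OF gS] by simp
    show "norm (x - y) \<le> diameter (g ` S) / c" if "x \<in> S" "y \<in> S" for x y
      using that c diameter_bounded_bound[OF gS, of "g x" "g y"] g
      by (auto simp: dist_norm[symmetric] field_simps)
  qed
  with c show "c * diameter S \<le> diameter (g ` S)"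
    by (simp add: field_simps)
qed

lemma hausdorff_gauge_similarity_image:
  fixes g :: "'a::real_normed_vector \<Rightarrow> 'b::real_normed_vector"
  assumes "c > 0" "\<And>x y. dist (g x) (g y) = c * dist x y" "bounded S"
  shows "hausdorff_gauge d (g ` S) = c powr d * hausdorff_gauge d S"
  using assms diameter_ge_0[OF assms(3)]
  by (simp add: hausdorff_gauge_def diameter_similarity_image powr_mult)

lemma hausdorff_premeasure_similarity_image_le:
  fixes g :: "'a::real_normed_vector \<Rightarrow> 'b::real_normed_vector"
  assumes c: "c > 0" and g: "\<And>x y. dist (g x) (g y) = c * dist x y"
  shows "ennreal (c powr - d) * hausdorff_premeasure d (c * \<epsilon>) (g ` S)
    \<le> hausdorff_premeasure d \<epsilon> S"
  unfolding hausdorff_premeasure_def[of d \<epsilon> S]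
proof (rule INF_greatest)
  fix U :: "nat \<Rightarrow> 'a set"
  assume "U \<in> {U. S \<subseteq> (\<Union>i. U i) \<and> (\<forall>i. bounded (U i) \<and> diameter (U i) \<le> \<epsilon>)}"
  then have SU: "S \<subseteq> (\<Union>i. U i)" and U: "\<And>i. bounded (U i)" "\<And>i. diameter (U i) \<le> \<epsilon>"
    by auto
  have "hausdorff_premeasure d (c * \<epsilon>) (g ` S) \<le> (\<Sum>i. ennreal (hausdorff_gauge d (g ` U i)))"
    unfolding hausdorff_premeasure_def
  proof (rule INF_lower, safe)
    show "g x \<in> (\<Union>i. g ` U i)" if "x \<in> S" for x
      using that SU unfolding image_UN[symmetric] by (intro imageI) (rule subsetD)
    show "bounded (g ` U i)" for i
      by (rule bounded_similarity_image[OF g U(1)])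
    show "diameter (g ` U i) \<le> c * \<epsilon>" for i
      using U c by (simp add: diameter_similarity_image[OF c g])
  qed
  also have "\<dots> = (\<Sum>i. ennreal (c powr d) * ennreal (hausdorff_gauge d (U i)))"
    using U by (simp add: hausdorff_gauge_similarity_image[OF c g] ennreal_mult')
  also have "\<dots> = ennreal (c powr d) * (\<Sum>i. ennreal (hausdorff_gauge d (U i)))"
    by simp
  finally have "ennreal (c powr - d) * hausdorff_premeasure d (c * \<epsilon>) (g ` S)
      \<le> ennreal (c powr - d) * (ennreal (c powr d) * (\<Sum>i. ennreal (hausdorff_gauge d (U i))))"
    by (rule mult_left_mono) simp
  also have "\<dots> = (\<Sum>i. ennreal (hausdorff_gauge d (U i)))"
    using c by (simp add: mult.assoc[symmetric] ennreal_mult'[symmetric] powr_add[symmetric])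
  finally show "ennreal (c powr - d) * hausdorff_premeasure d (c * \<epsilon>) (g ` S)
      \<le> (\<Sum>i. ennreal (hausdorff_gauge d (U i)))" .
qed

lemma hausdorff_measure_similarity_image_le:
  fixes g :: "'a::real_normed_vector \<Rightarrow> 'b::real_normed_vector"
  assumes c: "c > 0" and g: "\<And>x y. dist (g x) (g y) = c * dist x y"
  shows "ennreal (c powr - d) * hausdorff_measure d (g ` S) \<le> hausdorff_measure d S"
proof -
  have "ennreal (c powr - d) * hausdorff_measure d (g ` S)
      = (SUP \<epsilon>\<in>{0<..}. ennreal (c powr - d) * hausdorff_premeasure d \<epsilon> (g ` S))"
    unfolding hausdorff_measure_def by (rule SUP_mult_left_ennreal)
  also have "\<dots> \<le> hausdorff_measure d S"
  proof (rule SUP_least)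
    fix \<epsilon> :: real assume \<epsilon>: "\<epsilon> \<in> {0<..}"
    have "ennreal (c powr - d) * hausdorff_premeasure d \<epsilon> (g ` S)
        \<le> hausdorff_premeasure d (\<epsilon> / c) S"
      using hausdorff_premeasure_similarity_image_le[OF c g, of d "\<epsilon> / c" S] c by simp
    also have "\<dots> \<le> hausdorff_measure d S"
      unfolding hausdorff_measure_def by (rule SUP_upper) (use \<epsilon> c in simp)
    finally show "ennreal (c powr - d) * hausdorff_premeasure d \<epsilon> (g ` S)
        \<le> hausdorff_measure d S" .
  qed
  finally show ?thesis .
qed

text \<open>The lower bound is the preceding inequality for the inverse similarity. The order \<open>d\<close> is an
  arbitrary real number, so no sign of the Hausdorff dimension has to be known when this is
  applied.\<close>

lemma hausdorff_measure_affine_image: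
  fixes S :: "'a::real_normed_vector set"
  assumes c: "c > 0"
  shows "hausdorff_measure d ((\<lambda>x. a + c *\<^sub>R x) ` S) = ennreal (c powr d) * hausdorff_measure d S"
    (is "hausdorff_measure d (?g ` S) = _")
proof (rule antisym)
  define h where "h = (\<lambda>y. (1 / c) *\<^sub>R (y - a))"
  have g: "dist (?g x) (?g y) = c * dist x y" for x y
    using c by (simp add: dist_norm scaleR_diff_right[symmetric])
  have h: "dist (h x) (h y) = (1 / c) * dist x y" for x y
    using c by (simp add: h_def dist_norm scaleR_diff_right[symmetric])
  have hg: "h ` ?g ` S = S"
    using c by (simp add: image_image h_def)
  show "ennreal (c powr d) * hausdorff_measure d S \<le> hausdorff_measure d (?g ` S)"
    using hausdorff_measure_similarity_image_le[where g = h, OF _ h, of d "?g ` S"] c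
    unfolding hg by (simp add: powr_divide powr_minus)
  have "ennreal (c powr d) * (ennreal (c powr - d) * hausdorff_measure d (?g ` S))
      \<le> ennreal (c powr d) * hausdorff_measure d S"
    by (rule mult_left_mono[OF hausdorff_measure_similarity_image_le[OF c g]]) simp
  then show "hausdorff_measure d (?g ` S) \<le> ennreal (c powr d) * hausdorff_measure d S"
    using c by (simp add: mult.assoc[symmetric] ennreal_mult'[symmetric] powr_add[symmetric])
qed

section \<open>The Hilbert space of square-integrable classes\<close>

lemma borel_measurable_cnj [measurable (raw)]:
  "f \<in> borel_measurable M \<Longrightarrow> (\<lambda>x. cnj (f x)) \<in> borel_measurable M"
  by (rule borel_measurable_continuous_on[where f = cnj]) (intro continuous_intros)

lemma integrable_mult_cnj:
  assumes f: "square_integrable M f" and g: "square_integrable M g"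
  shows "integrable M (\<lambda>x. f x * cnj (g x))"
proof (rule Bochner_Integration.integrable_bound)
  show "integrable M (\<lambda>x. (cmod (f x))\<^sup>2 + (cmod (g x))\<^sup>2)"
    using f g by (auto simp: square_integrable_def)
  have [measurable]: "f \<in> borel_measurable M" "g \<in> borel_measurable M"
    using f g by (auto simp: square_integrable_def)
  show "(\<lambda>x. f x * cnj (g x)) \<in> borel_measurable M"
    by measurable
  have "a * b \<le> a\<^sup>2 + b\<^sup>2" if "a \<ge> 0" "b \<ge> 0" for a b :: real
    using sum_squares_bound[of a b] mult_nonneg_nonneg[OF that] by linarith
  then show "AE x in M. norm (f x * cnj (g x)) \<le> norm ((cmod (f x))\<^sup>2 + (cmod (g x))\<^sup>2)"
    by (simp add: norm_mult)
qed

lemma square_integrable_diff: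
  assumes f: "square_integrable M f" and g: "square_integrable M g"
  shows "square_integrable M (\<lambda>x. f x - g x)"
proof -
  have [measurable]: "f \<in> borel_measurable M" "g \<in> borel_measurable M"
    using f g by (auto simp: square_integrable_def)
  have bnd: "(cmod (a - b))\<^sup>2 \<le> 2 * (cmod a)\<^sup>2 + 2 * (cmod b)\<^sup>2" for a b :: complex
  proof -
    have "(cmod (a - b))\<^sup>2 \<le> (cmod a + cmod b)\<^sup>2"
      by (intro power_mono norm_triangle_ineq4) simp
    also have "\<dots> \<le> 2 * (cmod a)\<^sup>2 + 2 * (cmod b)\<^sup>2"
      using sum_squares_bound[of "cmod a" "cmod b"] by (simp add: power2_sum)
    finally show ?thesis .
  qed
  have "integrable M (\<lambda>x. (cmod (f x - g x))\<^sup>2)"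
  proof (rule Bochner_Integration.integrable_bound)
    show "integrable M (\<lambda>x. 2 * (cmod (f x))\<^sup>2 + 2 * (cmod (g x))\<^sup>2)"
      using f g by (auto simp: square_integrable_def)
    show "(\<lambda>x. (cmod (f x - g x))\<^sup>2) \<in> borel_measurable M"
      by measurable
    show "AE x in M. norm ((cmod (f x - g x))\<^sup>2) \<le> norm (2 * (cmod (f x))\<^sup>2 + 2 * (cmod (g x))\<^sup>2)"
      using bnd by simp
  qed
  then show ?thesis
    by (simp add: square_integrable_def)
qed

lemma L2_class_in_L2: "square_integrable M f \<Longrightarrow> L2_class M f \<in> L2 M"
  by (auto simp: L2_class_def L2_def intro: quotientI)

lemma L2E:
  assumes "F \<in> L2 M"
  obtains f where "square_integrable M f" "F = L2_class M f"
  using assms by (auto simp: L2_class_def L2_def elim!: quotientE)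

lemma mem_L2_class:
  "g \<in> L2_class M f \<longleftrightarrow>
    square_integrable M f \<and> square_integrable M g \<and> (AE x in M. f x = g x)"
  by (simp add: L2_class_def ae_rel_def)

lemma L2_class_eqI:
  assumes "square_integrable M f" "square_integrable M g" "AE x in M. f x = g x"
  shows "L2_class M f = L2_class M g"
proof -
  have "AE x in M. g x = f x"
    using assms(3) by eventually_elim simp
  then have "(AE x in M. f x = h x) \<longleftrightarrow> (AE x in M. g x = h x)" for h
    using assms(3) by (auto elim: eventually_elim2)
  with assms show ?thesis
    by (auto simp: mem_L2_class)
qed

lemma L2_inner_class:
  assumes f: "square_integrable M f" and g: "square_integrable M g"
  shows "L2_inner M (L2_class M f) (L2_class M g) = (LINT x|M. f x * cnj (g x))"
proof -
  have "(LINT x|M. f' x * cnj (g' x)) = (LINT x|M. f x * cnj (g x))"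
    if "f' \<in> L2_class M f" "g' \<in> L2_class M g" for f' g'
  proof (rule integral_cong_AE)
    show "AE x in M. f' x * cnj (g' x) = f x * cnj (g x)"
      using that by (auto simp: mem_L2_class elim: eventually_elim2)
  qed (use that in \<open>auto simp: mem_L2_class square_integrable_def\<close>)
  moreover have "f \<in> L2_class M f" "g \<in> L2_class M g"
    using f g by (auto simp: mem_L2_class)
  ultimately have "(\<Union>f'\<in>L2_class M f. \<Union>g'\<in>L2_class M g. {LINT x|M. f' x * cnj (g' x)})
      = {LINT x|M. f x * cnj (g x)}"
    by blast
  then show ?thesis
    by (simp add: L2_inner_def)
qed

lemma L2_inner_nondegenerate:
  assumes G: "G \<in> L2 M" and H: "H \<in> L2 M"
    and eq: "\<And>F. F \<in> L2 M \<Longrightarrow> L2_inner M F G = L2_inner M F H"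
  shows "G = H"
proof -
  obtain g where g: "square_integrable M g" "G = L2_class M g"
    using G by (rule L2E)
  obtain h where h: "square_integrable M h" "H = L2_class M h"
    using H by (rule L2E)
  define k where "k = (\<lambda>x. g x - h x)"
  have k: "square_integrable M k"
    unfolding k_def using g(1) h(1) by (rule square_integrable_diff)
  \<comment> \<open>Testing against \<open>g - h\<close> gives \<open>\<integral> |g - h|\<^sup>2 = 0\<close>.\<close>
  have "(LINT x|M. k x * cnj (g x)) = (LINT x|M. k x * cnj (h x))"
    using eq[OF L2_class_in_L2[OF k]] g h k by (simp add: L2_inner_class)
  then have "(LINT x|M. k x * cnj (g x) - k x * cnj (h x)) = 0"
    using integrable_mult_cnj[OF k g(1)] integrable_mult_cnj[OF k h(1)] by simp
  moreover have "k x * cnj (g x) - k x * cnj (h x) = complex_of_real ((cmod (k x))\<^sup>2)" for x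
    unfolding complex_norm_square by (simp add: k_def algebra_simps)
  ultimately have "(LINT x|M. (cmod (k x))\<^sup>2) = 0"
    by (simp only: integral_complex_of_real of_real_eq_0_iff)
  then have "AE x in M. (cmod (k x))\<^sup>2 = 0"
    using k integral_nonneg_eq_0_iff_AE[of M "\<lambda>x. (cmod (k x))\<^sup>2"]
    by (simp add: square_integrable_def)
  then have "AE x in M. g x = h x"
    by (simp add: k_def)
  with g h show ?thesis
    using L2_class_eqI by metis
qed

section \<open>Invariant densities\<close>

text \<open>If \<open>w\<close> is bounded above and below by positive constants, then \<open>M\<close> and the measure with
  density \<open>w\<close> have the same null sets and the same integrable functions. Invariance of the latter
  therefore makes \<open>\<psi> \<mapsto> \<psi> \<circ> s\<close> well defined on classes, and the change of variables
  \<open>\<integral> (\<psi> \<circ> s) w dM = \<integral> \<psi> w dM\<close> says that \<open>w\<close> represents the adjoint applied to \<open>w\<close>.\<close>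

lemma perron_frobenius_op_invariant_density:
  fixes M :: "'a measure" and w :: "'a \<Rightarrow> real"
  assumes fin: "finite_measure M"
    and s [measurable]: "s \<in> measurable M M"
    and w [measurable]: "w \<in> borel_measurable M"
    and a: "a > 0" and bounds: "\<And>x. x \<in> space M \<Longrightarrow> a \<le> w x \<and> w x \<le> b"
    and inv: "distr (density M w) M s = density M w"
  shows "square_integrable M (\<lambda>x. complex_of_real (w x))"
    and "perron_frobenius_op M s (L2_class M (\<lambda>x. complex_of_real (w x)))
      = L2_class M (\<lambda>x. complex_of_real (w x))"
proof -
  define D where "D = density M w"
  have [measurable_cong]: "sets D = sets M" by (simp add: D_def)
  have inv': "distr D M s = D" using inv by (simp add: D_def)
  have pos: "0 \<le> w x" if "x \<in> space M" for x
    using bounds[OF that] a by simp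
  have AE_D: "(AE x in D. P x) \<longleftrightarrow> (AE x in M. P x)" for P
  proof -
    have "(AE x in D. P x) \<longleftrightarrow> (AE x in M. 0 < w x \<longrightarrow> P x)"
      unfolding D_def by (subst AE_density) simp_all
    also have "\<dots> \<longleftrightarrow> (AE x in M. P x)"
      using bounds a by (intro AE_cong) force
    finally show ?thesis .
  qed
  have int_D: "integrable D h \<longleftrightarrow> integrable M h" if [measurable]: "h \<in> borel_measurable M"
    for h :: "'a \<Rightarrow> real"
  proof -
    have "integrable D h \<longleftrightarrow> integrable M (\<lambda>x. w x * h x)"
      unfolding D_def using pos by (subst integrable_density) auto
    also have "\<dots> \<longleftrightarrow> integrable M h"
    proof
      assume "integrable M (\<lambda>x. w x * h x)"
      then have *: "integrable M (\<lambda>x. w x * h x / a)" by simp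
      show "integrable M h"
      proof (rule Bochner_Integration.integrable_bound[OF *])
        have "\<bar>h x\<bar> \<le> \<bar>w x * h x / a\<bar>" if "x \<in> space M" for x
          using bounds[OF that] a
          by (simp add: abs_mult pos_le_divide_eq mult.commute mult_right_mono)
        then show "AE x in M. norm (h x) \<le> norm (w x * h x / a)" by auto
      qed measurable
    next
      assume "integrable M h"
      then have *: "integrable M (\<lambda>x. b * h x)" by simp
      show "integrable M (\<lambda>x. w x * h x)"
      proof (rule Bochner_Integration.integrable_bound[OF *])
        have "\<bar>w x * h x\<bar> \<le> \<bar>b * h x\<bar>" if "x \<in> space M" for x
          using bounds[OF that] a by (simp add: abs_mult mult_right_mono)
        then show "AE x in M. norm (w x * h x) \<le> norm (b * h x)" by auto
      qed measurable
    qed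
    finally show ?thesis .
  qed
  have sq_comp: "square_integrable M (\<psi> \<circ> s)" if "square_integrable M \<psi>" for \<psi>
  proof -
    have [measurable]: "\<psi> \<in> borel_measurable M" and "integrable M (\<lambda>x. (cmod (\<psi> x))\<^sup>2)"
      using that by (auto simp: square_integrable_def)
    then have "integrable (distr D M s) (\<lambda>x. (cmod (\<psi> x))\<^sup>2)"
      unfolding inv' by (subst int_D) auto
    then have "integrable D (\<lambda>x. (cmod (\<psi> (s x)))\<^sup>2)"
      by (subst (asm) integrable_distr_eq) auto
    then have "integrable M (\<lambda>x. (cmod (\<psi> (s x)))\<^sup>2)"
      by (subst (asm) int_D) auto
    then show ?thesis
      by (simp add: square_integrable_def comp_def)
  qed
  have AE_comp: "AE x in M. (\<phi> \<circ> s) x = (\<psi> \<circ> s) x"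
    if "square_integrable M \<phi>" "square_integrable M \<psi>" "AE x in M. \<phi> x = \<psi> x" for \<phi> \<psi>
  proof -
    have [measurable]: "\<phi> \<in> borel_measurable M" "\<psi> \<in> borel_measurable M"
      using that by (auto simp: square_integrable_def)
    have "AE x in distr D M s. \<phi> x = \<psi> x"
      unfolding inv' AE_D by fact
    then have "AE x in D. \<phi> (s x) = \<psi> (s x)"
      by (subst (asm) AE_distr_iff) auto
    then show ?thesis by (simp add: AE_D)
  qed
  have comp_class: "composition_op M s (L2_class M \<psi>) = L2_class M (\<psi> \<circ> s)"
    if \<psi>: "square_integrable M \<psi>" for \<psi>
  proof -
    have "L2_class M (\<phi> \<circ> s) = L2_class M (\<psi> \<circ> s)" if "\<phi> \<in> L2_class M \<psi>" for \<phi>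
      using that by (intro L2_class_eqI[symmetric] sq_comp AE_comp) (auto simp: mem_L2_class)
    moreover have "\<psi> \<in> L2_class M \<psi>" using \<psi> by (simp add: mem_L2_class)
    ultimately show ?thesis
      unfolding composition_op_def by blast
  qed
  let ?w = "\<lambda>x. complex_of_real (w x)"
  show w2: "square_integrable M ?w"
  proof -
    have "integrable M (\<lambda>x. (w x)\<^sup>2)"
    proof (rule finite_measure.integrable_const_bound[OF fin, of _ "b\<^sup>2"])
      show "AE x in M. norm ((w x)\<^sup>2) \<le> b\<^sup>2"
        using bounds pos by (auto intro!: power_mono)
    qed measurable
    then show ?thesis by (simp add: square_integrable_def)
  qed
  have duality: "L2_inner M (composition_op M s F) (L2_class M ?w) = L2_inner M F (L2_class M ?w)"
    if "F \<in> L2 M" for F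
  proof -
    from that obtain \<psi> where \<psi>: "square_integrable M \<psi>" "F = L2_class M \<psi>"
      by (rule L2E)
    then have [measurable]: "\<psi> \<in> borel_measurable M"
      by (simp add: square_integrable_def)
    have D_int: "(LINT x|D. h x) = (LINT x|M. h x * cnj (?w x))"
      if "h \<in> borel_measurable M" for h :: "'a \<Rightarrow> complex"
      unfolding D_def using that pos by (subst integral_density) (auto simp: scaleR_conv_of_real mult.commute)
    have "(LINT x|M. (\<psi> \<circ> s) x * cnj (?w x)) = (LINT x|D. \<psi> (s x))"
      by (subst D_int) auto
    also have "\<dots> = (LINT x|distr D M s. \<psi> x)"
      by (rule integral_distr[symmetric]) measurable
    also have "\<dots> = (LINT x|M. \<psi> x * cnj (?w x))"
      unfolding inv' by (subst D_int) auto
    finally show ?thesis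
      using \<psi> w2 sq_comp by (simp only: comp_class L2_inner_class)
  qed
  show "perron_frobenius_op M s (L2_class M ?w) = L2_class M ?w"
    unfolding perron_frobenius_op_def L2_adjoint_def
  proof (rule the_equality)
    show "L2_class M ?w \<in> L2 M \<and>
      (\<forall>F\<in>L2 M. L2_inner M (composition_op M s F) (L2_class M ?w) = L2_inner M F (L2_class M ?w))"
      using w2 duality by (simp add: L2_class_in_L2)
  next
    fix H
    assume H: "H \<in> L2 M \<and>
      (\<forall>F\<in>L2 M. L2_inner M (composition_op M s F) (L2_class M ?w) = L2_inner M F H)"
    show "H = L2_class M ?w"
    proof (rule L2_inner_nondegenerate)
      show "L2_inner M F H = L2_inner M F (L2_class M ?w)" if "F \<in> L2 M" for F
        using H that duality[OF that] by metis
    qed (use H w2 in \<open>auto intro: L2_class_in_L2\<close>)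
  qed
qed

section \<open>The shift on the sequence space\<close>

lemma shift_in_Lambda: "x \<in> Lambda A \<Longrightarrow> shift x \<in> Lambda A"
  by (simp add: Lambda_def shift_def)

text \<open>A sequence in \<open>Lambda A\<close> is the shift of one starting with \<open>i\<close> exactly when its first letter
  may follow \<open>i\<close>; the preimage prepends \<open>i\<close>.\<close>

lemma shift_image_cyl:
  assumes i: "i < dim_row A" and B: "B \<subseteq> Lambda A"
  shows "shift ` (cyl A i \<inter> shift -` B) = B \<inter> {y. A $$ (i, y 0) = 1}"
proof (intro equalityI subsetI)
  fix y assume "y \<in> shift ` (cyl A i \<inter> shift -` B)"
  then show "y \<in> B \<inter> {y. A $$ (i, y 0) = 1}"
    by (auto simp: cyl_def Lambda_def shift_def)
next
  fix y assume y: "y \<in> B \<inter> {y. A $$ (i, y 0) = 1}"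
  have "A $$ (case_nat i y k, case_nat i y (Suc k)) = 1" for k
    using y B by (cases k) (auto simp: Lambda_def)
  moreover have "case_nat i y k < dim_row A" for k
    using y i B by (cases k) (auto simp: Lambda_def)
  ultimately have "case_nat i y \<in> Lambda A"
    by (simp add: Lambda_def)
  moreover have "shift (case_nat i y) = y"
    by (simp add: shift_def)
  ultimately show "y \<in> shift ` (cyl A i \<inter> shift -` B)"
    using y by (intro image_eqI[of _ _ "case_nat i y"]) (auto simp: cyl_def)
qed

lemma expansion_value_shift:
  assumes N: "N \<ge> 2" and x: "\<And>k. x k < N"
  shows "expansion_value N (shift x) = - real (x 0) + real N * expansion_value N x"
proof -
  have "summable (\<lambda>k. real (x k) / real N ^ Suc k)"
  proof (rule summable_comparison_test)
    show "summable (\<lambda>k. (1 / real N) ^ k)"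
      using N by (intro summable_geometric) simp
    have "real (x k) / real N ^ Suc k \<le> real N / real N ^ Suc k" for k
      using x[of k] by (intro divide_right_mono) auto
    then show "\<exists>n0. \<forall>k\<ge>n0. norm (real (x k) / real N ^ Suc k) \<le> (1 / real N) ^ k"
      using N by (auto simp: power_divide)
  qed
  from suminf_split_head[OF this]
  have "(\<Sum>k. real (x (Suc k)) / real N ^ Suc (Suc k)) = expansion_value N x - real (x 0) / real N"
    by (simp add: expansion_value_def)
  moreover have "(\<Sum>k. real (x (Suc k)) / real N ^ Suc k)
      = (\<Sum>k. real N * (real (x (Suc k)) / real N ^ Suc (Suc k)))"
    using N by (intro suminf_cong) simp
  moreover have "\<dots> = real N * (\<Sum>k. real (x (Suc k)) / real N ^ Suc (Suc k))"
  proof (rule suminf_mult)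
    show "summable (\<lambda>k. real (x (Suc k)) / real N ^ Suc (Suc k))"
      using \<open>summable (\<lambda>k. real (x k) / real N ^ Suc k)\<close> by (subst summable_Suc_iff)
  qed
  ultimately show ?thesis
    using N by (simp add: expansion_value_def shift_def field_simps)
qed

lemma sets_hausdorff_Lambda: "sets (hausdorff_Lambda A) = sets (restrict_space borel (Lambda A))"
  and space_hausdorff_Lambda: "space (hausdorff_Lambda A) = Lambda A"
proof -
  have "sets (restrict_space borel (Lambda A)) \<subseteq> Pow (Lambda A)"
    using sets.space_closed[of "restrict_space borel (Lambda A)"] by (simp add: space_restrict_space)
  then show "space (hausdorff_Lambda A) = Lambda A"
    unfolding hausdorff_Lambda_def by (simp add: space_measure_of)
  show "sets (hausdorff_Lambda A) = sets (restrict_space borel (Lambda A))"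
    using sets.sets_measure_of_eq[of "restrict_space borel (Lambda A)"]
    unfolding hausdorff_Lambda_def by (simp add: space_restrict_space)
qed

lemma sets_mu: "sets (mu A) = sets (restrict_space borel (Lambda A))"
  and space_mu: "space (mu A) = Lambda A"
  by (simp_all add: mu_def sets_hausdorff_Lambda space_hausdorff_Lambda)

lemma measurable_shift: "shift \<in> measurable (mu A) (mu A)"
proof -
  have "continuous_on UNIV shift"
    unfolding shift_def by (intro continuous_on_coordinatewise_then_product continuous_on_product_coordinates)
  then have "shift \<in> measurable (restrict_space borel (Lambda A)) (restrict_space borel (Lambda A))"
    by (intro measurable_restrict_space3 borel_measurable_continuous_onI) (auto intro: shift_in_Lambda)
  then show ?thesis
    by (simp add: measurable_cong_sets[OF sets_mu sets_mu])
qed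

lemma measurable_first_letter: "(\<lambda>x. x 0) \<in> measurable (mu A) (count_space UNIV)"
proof -
  have "(\<lambda>x::nat \<Rightarrow> nat. x 0) \<in> borel_measurable borel"
    by (intro borel_measurable_continuous_onI continuous_on_product_coordinates)
  then have "(\<lambda>x::nat \<Rightarrow> nat. x 0) \<in> measurable borel (count_space UNIV)"
    by (simp add: measurable_cong_sets[OF refl sets_borel_eq_count_space])
  then show ?thesis
    using measurable_restrict_space1 by (simp add: measurable_cong_sets[OF sets_mu refl])
qed

lemma sets_cyl: "cyl A i \<in> sets (mu A)"
  using measurable_sets[OF measurable_first_letter[of A], of "{i}"]
  by (simp add: cyl_def space_mu vimage_def Int_def conj_commute)

text \<open>On a cylinder the shift acts on values as the similarity \<open>t \<mapsto> N t - i\<close>, and so multiplies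
  the Hausdorff measure by \<open>N powr \<delta>\<close>. If the set function in \<open>hausdorff_Lambda\<close> is not
  countably additive, then \<open>measure_of\<close> yields the zero measure and both sides vanish.\<close>

lemma emeasure_hausdorff_Lambda_shift:
  assumes N: "dim_row A \<ge> 2" and i: "i < dim_row A" and B: "B \<in> sets (mu A)"
  shows "emeasure (hausdorff_Lambda A) (B \<inter> {y. A $$ (i, y 0) = 1})
    = ennreal (real (dim_row A) powr delta A) * emeasure (hausdorff_Lambda A) (cyl A i \<inter> shift -` B)"
proof -
  let ?\<pi> = "expansion_value (dim_row A)" and ?C = "cyl A i \<inter> shift -` B"
  let ?F = "B \<inter> {y. A $$ (i, y 0) = 1}"
  let ?m = "\<lambda>E. hausdorff_measure (delta A) (?\<pi> ` E)"
  let ?S = "sets (restrict_space borel (Lambda A))"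
  have B': "B \<subseteq> Lambda A"
    using sets.sets_into_space[OF B] by (simp add: space_mu)
  have "(\<lambda>x. x 0) -` {j. A $$ (i, j) = 1} \<inter> space (mu A) \<in> sets (mu A)"
    by (rule measurable_sets[OF measurable_first_letter]) simp
  from sets.Int[OF B this] have "B \<inter> ((\<lambda>x. x 0) -` {j. A $$ (i, j) = 1} \<inter> Lambda A) \<in> ?S"
    by (simp add: space_mu sets_mu)
  moreover have "B \<inter> ((\<lambda>x. x 0) -` {j. A $$ (i, j) = 1} \<inter> Lambda A) = ?F"
    using B' by auto
  ultimately have F: "?F \<in> ?S" by simp
  have "shift -` B \<inter> space (mu A) \<in> sets (mu A)"
    by (rule measurable_sets[OF measurable_shift B])
  from sets.Int[OF sets_cyl this, of i] have "cyl A i \<inter> (shift -` B \<inter> Lambda A) \<in> ?S"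
    by (simp add: space_mu sets_mu)
  moreover have "cyl A i \<inter> (shift -` B \<inter> Lambda A) = ?C"
    by (auto simp: cyl_def)
  ultimately have C: "?C \<in> ?S" by simp
  have em: "emeasure (hausdorff_Lambda A) E = (if measure_space (Lambda A) ?S ?m then ?m E else 0)"
    if "E \<in> ?S" for E
  proof -
    have "sigma_sets (Lambda A) ?S = ?S"
      using sets.sigma_sets_eq[of "restrict_space borel (Lambda A)"] by (simp add: space_restrict_space)
    then show ?thesis
      using that by (simp add: hausdorff_Lambda_def emeasure_measure_of_conv)
  qed
  have pos: "real (dim_row A) > 0"
    using N by simp
  have "?\<pi> (shift x) = - real i + real (dim_row A) *\<^sub>R ?\<pi> x" if "x \<in> ?C" for x
    using that expansion_value_shift[OF N, of x] by (simp add: cyl_def Lambda_def)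
  then have "?\<pi> ` ?F = (\<lambda>t. - real i + real (dim_row A) *\<^sub>R t) ` (?\<pi> ` ?C)"
    unfolding shift_image_cyl[OF i B', symmetric] image_image by (rule image_cong[OF refl])
  then have "?m ?F = ennreal (real (dim_row A) powr delta A) * ?m ?C"
    using hausdorff_measure_affine_image[OF pos] by (simp only:)
  then show ?thesis
    by (simp add: em[OF F] em[OF C])
qed

text \<open>Normalizing a measure of total mass \<open>0\<close> or \<open>\<infinity>\<close> gives the zero measure, since
  \<open>0 / 0 = 0\<close> and \<open>\<infinity> / \<infinity> = 0\<close> in \<open>ennreal\<close>; hence finiteness holds in every case.\<close>

lemma finite_measure_mu: "finite_measure (mu A)"
proof
  have "emeasure (mu A) (space (mu A))
      = emeasure (hausdorff_Lambda A) (Lambda A) / emeasure (hausdorff_Lambda A) (Lambda A)"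
    by (simp add: mu_def space_hausdorff_Lambda[of A, symmetric])
  also have "\<dots> \<noteq> \<infinity>"
    by (cases "emeasure (hausdorff_Lambda A) (Lambda A) = 0 \<or> emeasure (hausdorff_Lambda A) (Lambda A) = \<infinity>")
      (auto simp: less_top[symmetric])
  finally show "emeasure (mu A) (space (mu A)) \<noteq> \<infinity>" .
qed

text \<open>With \<open>B = Lambda A\<close> this says that the vector of measures of the cylinders is mapped by \<open>A\<close>
  to \<open>N powr \<delta>\<close> times itself.\<close>

lemma measure_mu_shift:
  assumes N: "dim_row A \<ge> 2" and i: "i < dim_row A" and B: "B \<in> sets (mu A)"
    and A01: "\<And>j. j < dim_row A \<Longrightarrow> A $$ (i, j) \<in> {0, 1}"
  shows "(\<Sum>j<dim_row A. A $$ (i, j) * measure (mu A) (B \<inter> cyl A j))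
    = real (dim_row A) powr delta A * measure (mu A) (cyl A i \<inter> shift -` B)"
proof -
  interpret finite_measure "mu A" by (rule finite_measure_mu)
  let ?M = "hausdorff_Lambda A" and ?F = "B \<inter> {y. A $$ (i, y 0) = 1}"
  let ?C = "cyl A i \<inter> shift -` B"
  let ?J = "{j. j < dim_row A \<and> A $$ (i, j) = 1}"
  have B': "B \<subseteq> Lambda A"
    using sets.sets_into_space[OF B] by (simp add: space_mu)
  have F_eq: "?F = (\<Union>j\<in>?J. B \<inter> cyl A j)"
    using B' by (auto simp: cyl_def Lambda_def)
  have BC: "B \<inter> cyl A j \<in> sets (mu A)" for j
    using B sets_cyl by auto
  have F: "?F \<in> sets (mu A)"
    unfolding F_eq using BC by (intro sets.finite_UN) auto
  have "?C = cyl A i \<inter> (shift -` B \<inter> space (mu A))"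
    by (auto simp: cyl_def space_mu)
  then have C: "?C \<in> sets (mu A)"
    using measurable_sets[OF measurable_shift B] sets_cyl by auto
  have em: "emeasure (mu A) E = emeasure ?M E / emeasure ?M (Lambda A)" if "E \<in> sets (mu A)" for E
  proof -
    have "Lambda A \<inter> E = E"
      using sets.sets_into_space[OF that] by (auto simp: space_mu)
    moreover have "Lambda A \<in> sets ?M"
      using sets.top[of ?M] by (simp add: space_hausdorff_Lambda)
    ultimately show ?thesis
      using that by (simp add: mu_def)
  qed
  have "emeasure (mu A) ?F = ennreal (real (dim_row A) powr delta A) * emeasure (mu A) ?C"
    unfolding em[OF F] em[OF C] emeasure_hausdorff_Lambda_shift[OF N i B]
    by (simp add: ennreal_times_divide)
  then have "measure (mu A) ?F = real (dim_row A) powr delta A * measure (mu A) ?C"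
    by (simp add: measure_def enn2real_mult)
  moreover have "measure (mu A) ?F = (\<Sum>j\<in>?J. measure (mu A) (B \<inter> cyl A j))"
    unfolding F_eq
    by (rule finite_measure_finite_Union) (use BC in \<open>auto simp: disjoint_family_on_def cyl_def\<close>)
  moreover have "\<dots> = (\<Sum>j<dim_row A. A $$ (i, j) * measure (mu A) (B \<inter> cyl A j))"
    using A01 by (intro sum.mono_neutral_cong_left) auto
  ultimately show ?thesis by simp
qed

section \<open>The Perron--Frobenius eigenvector as an invariant density\<close>

lemma emeasure_density_mu:
  assumes w: "\<And>i. i < dim_row A \<Longrightarrow> w i \<ge> 0" and B: "B \<in> sets (mu A)"
  shows "emeasure (density (mu A) (\<lambda>x. ennreal (w (x 0)))) B
    = ennreal (\<Sum>i<dim_row A. w i * measure (mu A) (B \<inter> cyl A i))"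
proof -
  interpret finite_measure "mu A" by (rule finite_measure_mu)
  have BC [measurable]: "B \<inter> cyl A j \<in> sets (mu A)" for j
    using B sets_cyl by auto
  note measurable_first_letter [measurable]
  have "emeasure (density (mu A) (\<lambda>x. ennreal (w (x 0)))) B
      = (\<integral>\<^sup>+x. ennreal (w (x 0)) * indicator B x \<partial>mu A)"
    using B by (intro emeasure_density) measurable
  also have "\<dots> = (\<integral>\<^sup>+x. (\<Sum>i<dim_row A. ennreal (w i) * indicator (B \<inter> cyl A i) x) \<partial>mu A)"
  proof (rule nn_integral_cong)
    fix x assume "x \<in> space (mu A)"
    then have x: "x \<in> Lambda A" "x 0 < dim_row A"
      by (auto simp: space_mu Lambda_def)
    have "(\<Sum>i<dim_row A. ennreal (w i) * indicator (B \<inter> cyl A i) x)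
        = (\<Sum>i<dim_row A. if i = x 0 then ennreal (w i) * indicator B x else 0)"
      using x by (intro sum.cong) (auto simp: cyl_def indicator_def)
    then show "ennreal (w (x 0)) * indicator B x
        = (\<Sum>i<dim_row A. ennreal (w i) * indicator (B \<inter> cyl A i) x)"
      using x by simp
  qed
  also have "\<dots> = (\<Sum>i<dim_row A. ennreal (w i) * emeasure (mu A) (B \<inter> cyl A i))"
    by (subst nn_integral_sum) (auto simp: nn_integral_cmult_indicator)
  also have "\<dots> = (\<Sum>i<dim_row A. ennreal (w i * measure (mu A) (B \<inter> cyl A i)))"
    using w by (intro sum.cong) (auto simp: emeasure_eq_measure ennreal_mult')
  also have "\<dots> = ennreal (\<Sum>i<dim_row A. w i * measure (mu A) (B \<inter> cyl A i))"
    using w by (intro sum_ennreal) auto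
  finally show ?thesis .
qed

text \<open>The left eigenvector relation turns the scaling of the cylinders into
  \<open>c \<nu>(\<sigma>\<^sup>-\<^sup>1 B) = r \<nu>(B)\<close> with \<open>c = N powr \<delta>\<close>, where \<open>\<nu>\<close> has density \<open>w (x 0)\<close>. The
  choice \<open>B = Lambda A\<close> then forces \<open>c = r\<close>, unless \<open>\<nu>\<close> is the zero measure.\<close>

lemma shift_invariant_density:
  assumes N: "dim_row A \<ge> 2"
    and A01: "\<And>i j. i < dim_row A \<Longrightarrow> j < dim_row A \<Longrightarrow> A $$ (i, j) \<in> {0, 1}"
    and w: "\<And>i. i < dim_row A \<Longrightarrow> w i > 0"
    and eig: "\<And>j. j < dim_row A \<Longrightarrow> (\<Sum>i<dim_row A. w i * A $$ (i, j)) = r * w j"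
  shows "distr (density (mu A) (\<lambda>x. ennreal (w (x 0)))) (mu A) shift
    = density (mu A) (\<lambda>x. ennreal (w (x 0)))"
proof -
  interpret finite_measure "mu A" by (rule finite_measure_mu)
  let ?D = "density (mu A) (\<lambda>x. ennreal (w (x 0)))"
  define n where "n = dim_row A"
  define c where "c = real n powr delta A"
  define \<nu> where "\<nu> B = (\<Sum>i<n. w i * measure (mu A) (B \<inter> cyl A i))" for B
  have c: "c > 0"
    using N by (simp add: c_def n_def)
  have pre: "shift -` B \<inter> Lambda A \<in> sets (mu A)" if "B \<in> sets (mu A)" for B
    using measurable_sets[OF measurable_shift that] by (simp add: space_mu)
  have D: "emeasure ?D B = ennreal (\<nu> B)" if "B \<in> sets (mu A)" for B
    unfolding \<nu>_def n_def using w that by (intro emeasure_density_mu) (auto intro: less_imp_le)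
  have scaling: "c * \<nu> (shift -` B \<inter> Lambda A) = r * \<nu> B" if B: "B \<in> sets (mu A)" for B
  proof -
    have cyl: "shift -` B \<inter> Lambda A \<inter> cyl A i = cyl A i \<inter> shift -` B" for i
      by (auto simp: cyl_def)
    have "c * \<nu> (shift -` B \<inter> Lambda A)
        = (\<Sum>i<n. w i * (c * measure (mu A) (cyl A i \<inter> shift -` B)))"
      by (simp add: \<nu>_def cyl sum_distrib_left mult_ac)
    also have "\<dots> = (\<Sum>i<n. w i * (\<Sum>j<n. A $$ (i, j) * measure (mu A) (B \<inter> cyl A j)))"
      unfolding c_def n_def using measure_mu_shift[OF N _ B] A01 by (intro sum.cong) auto
    also have "\<dots> = (\<Sum>j<n. \<Sum>i<n. w i * A $$ (i, j) * measure (mu A) (B \<inter> cyl A j))"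
      by (subst sum.swap) (simp add: sum_distrib_left mult_ac)
    also have "\<dots> = (\<Sum>j<n. (\<Sum>i<n. w i * A $$ (i, j)) * measure (mu A) (B \<inter> cyl A j))"
      by (simp add: sum_distrib_right)
    also have "\<dots> = r * \<nu> B"
      using eig by (simp add: \<nu>_def n_def sum_distrib_left mult_ac)
    finally show ?thesis .
  qed
  have top: "Lambda A \<in> sets (mu A)"
    using sets.top[of "mu A"] by (simp add: space_mu)
  have mono: "\<nu> B \<le> \<nu> (Lambda A)" if B: "B \<in> sets (mu A)" for B
    unfolding \<nu>_def
  proof (intro sum_mono mult_left_mono finite_measure_mono)
    show "B \<inter> cyl A i \<subseteq> Lambda A \<inter> cyl A i" for i
      using sets.sets_into_space[OF B] by (auto simp: space_mu)
    show "Lambda A \<inter> cyl A i \<in> sets (mu A)" for i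
      using top sets_cyl by (rule sets.Int)
  qed (use w in \<open>auto simp: n_def intro: less_imp_le\<close>)
  have nonneg: "\<nu> B \<ge> 0" for B
    unfolding \<nu>_def using w by (intro sum_nonneg mult_nonneg_nonneg) (auto simp: n_def intro: less_imp_le)
  have inv: "\<nu> (shift -` B \<inter> Lambda A) = \<nu> B" if B: "B \<in> sets (mu A)" for B
  proof (cases "\<nu> (Lambda A) = 0")
    case True
    then show ?thesis
      using mono[OF B] mono[OF pre[OF B]] nonneg[of B] nonneg[of "shift -` B \<inter> Lambda A"] by simp
  next
    case False
    have "shift -` Lambda A \<inter> Lambda A = Lambda A"
      using shift_in_Lambda by auto
    with scaling[OF top] False have "r = c" by simp
    with scaling[OF B] c show ?thesis by simp
  qed
  show ?thesis
  proof (rule measure_eqI)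
    fix B assume "B \<in> sets (distr ?D (mu A) shift)"
    then have B: "B \<in> sets (mu A)" by simp
    have "emeasure (distr ?D (mu A) shift) B = emeasure ?D (shift -` B \<inter> Lambda A)"
      using B measurable_shift[of A] by (subst emeasure_distr) (auto simp: space_mu)
    then show "emeasure (distr ?D (mu A) shift) B = emeasure ?D B"
      using B pre[OF B] by (simp add: D inv)
  qed simp
qed

theorem proposition2p19:
  fixes N :: nat and A :: "real mat" and \<omega> :: "real vec" and f :: "(nat \<Rightarrow> nat) \<Rightarrow> complex"
  assumes "N \<ge> 2"
    and "A \<in> carrier_mat N N"
    and "\<And>i j. i < N \<Longrightarrow> j < N \<Longrightarrow> A $$ (i, j) \<in> {0, 1}"
    and "\<And>i. i < N \<Longrightarrow> A $$ (i, i) = 1"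
    and "irreducible_mat A"
    and "eigenvector (transpose_mat A) \<omega> (spec_rad A)"
    and "\<And>i. i < N \<Longrightarrow> \<omega> $ i > 0"
  defines "f \<equiv> \<lambda>x. \<Sum>i<N. complex_of_real (\<omega> $ i) * indicator (cyl A i) x"
  shows "L2_class (mu A) f \<in> L2 (mu A)
    \<and> perron_frobenius_op (mu A) shift (L2_class (mu A) f) = L2_class (mu A) f"
proof -
  let ?w = "\<lambda>x :: nat \<Rightarrow> nat. \<omega> $ (x 0)"
  let ?g = "\<lambda>x. complex_of_real (?w x)"
  have dim: "dim_row A = N" "dim_col A = N"
    using assms(2) by auto
  have \<omega>: "dim_vec \<omega> = N" "transpose_mat A *\<^sub>v \<omega> = spec_rad A \<cdot>\<^sub>v \<omega>"
    using assms(6) dim by (auto simp: eigenvector_def)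
  have eig: "(\<Sum>i<N. \<omega> $ i * A $$ (i, j)) = spec_rad A * \<omega> $ j" if "j < N" for j
  proof -
    have "(transpose_mat A *\<^sub>v \<omega>) $ j = (\<Sum>i<N. \<omega> $ i * A $$ (i, j))"
      using that dim \<omega>(1) by (simp add: scalar_prod_def atLeast0LessThan mult.commute)
    then show ?thesis
      using that \<omega> by simp
  qed
  have first: "x 0 < N" if "x \<in> space (mu A)" for x
    using that dim by (simp add: space_mu Lambda_def)
  have inv: "distr (density (mu A) ?w) (mu A) shift = density (mu A) ?w"
    using assms(1,3,7) eig by (intro shift_invariant_density) (auto simp: dim)
  have meas: "?w \<in> borel_measurable (mu A)"
    by (rule measurable_compose[OF measurable_first_letter, where g = "\<lambda>i. \<omega> $ i"]) simp
  let ?a = "Min ((\<lambda>i. \<omega> $ i) ` {..<N})" and ?b = "Max ((\<lambda>i. \<omega> $ i) ` {..<N})"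
  have a: "?a > 0"
    using assms(1,7) by (subst Min_gr_iff) (auto simp: lessThan_empty_iff)
  have bounds: "?a \<le> ?w x \<and> ?w x \<le> ?b" if "x \<in> space (mu A)" for x
    using first[OF that] by auto
  have fixed: "square_integrable (mu A) ?g"
    "perron_frobenius_op (mu A) shift (L2_class (mu A) ?g) = L2_class (mu A) ?g"
    by (rule perron_frobenius_op_invariant_density[where a = ?a and b = ?b];
      fact finite_measure_mu measurable_shift meas a bounds inv)+
  have f_eq: "f x = ?g x" if "x \<in> space (mu A)" for x
  proof -
    have "f x = (\<Sum>i<N. if i = x 0 then complex_of_real (\<omega> $ i) else 0)"
      unfolding f_def using that by (intro sum.cong) (auto simp: cyl_def space_mu indicator_def)
    then show ?thesis
      using first[OF that] by simp
  qed
  have "square_integrable (mu A) f"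
    using fixed(1) f_eq unfolding square_integrable_def
    by (simp cong: measurable_cong Bochner_Integration.integrable_cong)
  moreover from this have "L2_class (mu A) f = L2_class (mu A) ?g"
    using fixed(1) f_eq by (intro L2_class_eqI) auto
  ultimately show ?thesis
    using fixed by (simp add: L2_class_in_L2)
qed

end
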